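(* Let $d,n\in\mathbb{N}$, let $f\in\Pi_n^d$, and let $\gamma=\gamma_{d,n}:[0,1]\to\mathbb{T}^d$ be the curve $$\gamma(y)=\left(y,(2n+1)y,\dots,(2n+1)^{d-1}y\right)\bmod 1.$$ Then $$\frac{1}{\ell(\gamma)}\int_\gamma f(x)\,\mathrm{d}\sigma(x)=\int_{\mathbb{T}^d}f(x)\,\mathrm{d}x.$$
   Context: $\mathbb{N}=\{1,2,\dots\}$. $\mathbb{T}^d\simeq[0,1)^d$ is the $d$-dimensional torus ($\mathbb{R}^d/\mathbb{Z}^d$) with normalized Lebesgue measure $\mathrm{d}x$; "mod 1" is taken componentwise. $\Pi_n^d$ is the space of trigonometric polynomials $f(x)=\sum_{k\in\mathbb{Z}^d,\ \|k\|_\infty\le n}c_k\,\mathrm{e}^{2\pi i k\cdot x}$, $c_k\in\mathbb{C}$, on $\mathbb{T}^d$. Integration along a curve is with respect to arc length, $\int_\gamma g(x)\,\mathrm{d}\sigma(x)=\int_0^1 g(\gamma(t))\|\dot\gamma(t)\|_2\,\mathrm{d}t$, and the length is $\ell(\gamma)=\int_0^1\|\dot\gamma(t)\|_2\,\mathrm{d}t$. *)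

theory Defs
  imports "HOL-Analysis.Analysis"
begin

text \<open>The torus is represented by its fundamental domain, the half-open unit cube; reduction
  modulo 1 is the quotient map. Since the cube has Lebesgue measure 1, the restriction of
  \<^const>\<open>lborel\<close> to it is the normalized Haar measure.\<close>

definition torus :: "(real ^ 'd) set" where
  "torus = {x. \<forall>i. 0 \<le> x $ i \<and> x $ i < 1}"

definition mod1 :: "real ^ 'd \<Rightarrow> real ^ 'd" where
  "mod1 x = (\<chi> i. frac (x $ i))"

text \<open>The linear order on the index type numbers the coordinates, starting from 0.\<close>

definition coord_pos :: "'d :: {finite, linorder} \<Rightarrow> nat" where
  "coord_pos i = card {..<i}"

definition torus_integral :: "(real ^ 'd \<Rightarrow> complex) \<Rightarrow> complex" where
  "torus_integral f = (LINT x:torus|lborel. f x)"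

definition real_vec :: "int ^ 'd \<Rightarrow> real ^ 'd" where
  "real_vec k = (\<chi> i. real_of_int (k $ i))"

definition freqs :: "nat \<Rightarrow> (int ^ 'd) set" where
  "freqs n = {k. infnorm (real_vec k) \<le> real n}"

text \<open>Only the values on the torus matter; outside of it, members of this set are arbitrary.\<close>

definition trig_polys :: "nat \<Rightarrow> (real ^ 'd \<Rightarrow> complex) set" where
  "trig_polys n = {f. \<exists>c :: int ^ 'd \<Rightarrow> complex. \<forall>x\<in>torus.
     f x = (\<Sum>k\<in>freqs n. c k * exp (2 * of_real pi * \<i> * of_real (real_vec k \<bullet> x)))}"

text \<open>A curve in the torus, written in the unit cube, jumps where it crosses a face, so its
  velocity is that of a lift to Euclidean space. A lift differentiable at a given time is
  continuous there, hence any two such lifts differ near that time by a constant integer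
  vector, and the velocity does not depend on the lift.\<close>

definition has_torus_velocity :: "(real \<Rightarrow> real ^ 'd) \<Rightarrow> real ^ 'd \<Rightarrow> real \<Rightarrow> bool" where
  "has_torus_velocity \<gamma> v t \<longleftrightarrow>
     (\<exists>\<Gamma>. (\<forall>s\<in>{0..1}. mod1 (\<Gamma> s) = \<gamma> s) \<and> (\<Gamma> has_vector_derivative v) (at t within {0..1}))"

definition torus_velocity :: "(real \<Rightarrow> real ^ 'd) \<Rightarrow> real \<Rightarrow> real ^ 'd" where
  "torus_velocity \<gamma> t = (THE v. has_torus_velocity \<gamma> v t)"

definition curve_length :: "(real \<Rightarrow> real ^ 'd) \<Rightarrow> real" where
  "curve_length \<gamma> = (LINT t:{0..1}|lborel. norm (torus_velocity \<gamma> t))"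

definition curve_integral :: "(real \<Rightarrow> real ^ 'd) \<Rightarrow> (real ^ 'd \<Rightarrow> complex) \<Rightarrow> complex" where
  "curve_integral \<gamma> g =
     (LINT t:{0..1}|lborel. g (\<gamma> t) * of_real (norm (torus_velocity \<gamma> t)))"

lemma finite_freqs: "finite (freqs n :: (int ^ 'd) set)"
proof -
  have "freqs n \<subseteq> vec_lambda ` (UNIV \<rightarrow>\<^sub>E {- int n..int n} :: ('d \<Rightarrow> int) set)"
  proof
    fix k :: "int ^ 'd"
    assume "k \<in> freqs n"
    then have "\<bar>real_vec k $ i\<bar> \<le> real n" for i
      using component_le_infnorm_cart[of "real_vec k" i] by (simp add: freqs_def)
    then have "\<bar>k $ i\<bar> \<le> int n" for i
      unfolding real_vec_def by (metis of_int_abs of_int_le_iff of_int_of_nat_eq vec_lambda_beta)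
    then have "vec_nth k \<in> UNIV \<rightarrow>\<^sub>E {- int n..int n}"
      by (auto simp: abs_le_iff PiE_def Pi_def) (metis minus_le_iff)
    then show "k \<in> vec_lambda ` (UNIV \<rightarrow>\<^sub>E {- int n..int n})"
      by (metis imageI vec_nth_inverse)
  qed
  then show ?thesis
    by (meson finite finite_PiE finite_atLeastAtMost_int finite_imageI finite_subset)
qed

lemma has_torus_velocity_unique:
  fixes \<gamma> :: "real \<Rightarrow> real ^ 'd"
  assumes t: "t \<in> {0..1}"
    and v: "has_torus_velocity \<gamma> v t" and w: "has_torus_velocity \<gamma> w t"
  shows "v = w"
proof -
  let ?F = "at t within {0..1::real}"
  obtain G where G: "\<forall>s\<in>{0..1}. mod1 (G s) = \<gamma> s" "(G has_vector_derivative v) ?F"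
    using v unfolding has_torus_velocity_def by blast
  obtain H where H: "\<forall>s\<in>{0..1}. mod1 (H s) = \<gamma> s" "(H has_vector_derivative w) ?F"
    using w unfolding has_torus_velocity_def by blast
  define D where "D s = G s - H s" for s
  have D': "(D has_vector_derivative (v - w)) ?F"
    unfolding D_def by (intro has_vector_derivative_diff G H)
  have int: "D s $ i \<in> \<int>" if "s \<in> {0..1}" for s i
  proof -
    have "mod1 (G s) $ i = mod1 (H s) $ i" using G(1) H(1) that by simp
    then have "D s $ i = of_int (\<lfloor>G s $ i\<rfloor> - \<lfloor>H s $ i\<rfloor>)"
      by (simp add: mod1_def frac_def D_def)
    then show ?thesis by (metis Ints_of_int)
  qed
  have "continuous ?F D"
    using D' by (rule has_vector_derivative_continuous)
  then have "(D \<longlongrightarrow> D t) ?F"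
    by (simp add: continuous_within)
  then have "eventually (\<lambda>s. dist (D s) (D t) < 1) ?F"
    by (rule tendstoD) simp
  then obtain e where e: "e > 0"
    "\<And>s. s \<in> {0..1} \<Longrightarrow> s \<noteq> t \<Longrightarrow> dist s t < e \<Longrightarrow> dist (D s) (D t) < 1"
    unfolding eventually_at by auto
  have const: "D s = D t" if "s \<in> {0..1}" "dist s t < e" for s
  proof (cases "s = t")
    case False
    show ?thesis
    proof (rule vec_eq_iff[THEN iffD2], rule allI)
      fix i
      have "\<bar>(D s - D t) $ i\<bar> < 1"
        using e(2)[OF that(1) False that(2)] component_le_norm_cart[of "D s - D t" i]
        by (simp add: dist_norm)
      moreover have "(D s - D t) $ i \<in> \<int>"
        using int[OF that(1)] int[OF t] by simp
      ultimately have "(D s - D t) $ i = 0"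
        using Ints_nonzero_abs_less1 by blast
      then show "D s $ i = D t $ i" by simp
    qed
  qed simp
  have "(D has_vector_derivative 0) ?F"
    by (rule has_vector_derivative_transform_within[OF _ e(1) t, of "\<lambda>_. D t"])
       (use const in \<open>auto simp: dist_commute\<close>)
  then have "v - w = 0"
    using vector_derivative_unique_within_closed_interval[of 0 1 t D "v - w" 0] t D'
    by (simp add: cbox_interval)
  then show ?thesis by simp
qed

end

theory Submission
  imports Defs
begin

text \<open>The curve has constant velocity, so its normalized integral is the integral of \<open>f \<circ> \<gamma>\<close> over
  the unit interval. Along the curve the character of frequency \<open>k\<close> becomes the character
  of frequency \<open>\<Sum>i. k\<^sub>i (2n + 1)\<^sup>i\<close> on the circle. These are balanced digits in base \<open>2n + 1\<close>, so
  the sum vanishes only for \<open>k = 0\<close>: each nonconstant character integrates to 0 on both sides.\<close>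

lemma coord_pos_strict_mono: "i < j \<Longrightarrow> coord_pos i < coord_pos j"
  unfolding coord_pos_def by (rule psubset_card_mono) auto

text \<open>This turns the bound on a real norm into the bound on integer digits that
  \<open>balanced_digits_eq_0\<close> takes as its hypothesis.\<close>

lemma freqs_component:
  assumes "k \<in> freqs n"
  shows "\<bar>k $ i\<bar> \<le> int n"
proof -
  have "\<bar>real_vec k $ i\<bar> \<le> real n"
    using component_le_infnorm_cart[of "real_vec k" i] assms by (simp add: freqs_def)
  then show ?thesis
    unfolding real_vec_def by (metis of_int_abs of_int_le_iff of_int_of_nat_eq vec_lambda_beta)
qed

lemma zero_in_freqs: "0 \<in> freqs n"
  by (simp add: freqs_def real_vec_def infnorm_eq_0[THEN iffD2] vec_eq_iff)

text \<open>Take the lowest nonzero digit, at position p, and put N = 2n + 1. Every other term is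
  divisible by N^(p+1), so the term at p is too, and N divides its digit. That digit is nonzero with
  absolute value at most n < N, a contradiction.\<close>

lemma balanced_digits_eq_0:
  fixes k :: "int ^ 'd :: {finite, linorder}"
  assumes digits: "\<And>i. \<bar>k $ i\<bar> \<le> int n"
    and sum0: "(\<Sum>i\<in>UNIV. k $ i * (2 * int n + 1) ^ coord_pos i) = 0"
  shows "k = 0"
proof (rule ccontr)
  assume "k \<noteq> 0"
  define S where "S = {i. k $ i \<noteq> 0}"
  have "S \<noteq> {}" using \<open>k \<noteq> 0\<close> by (auto simp: S_def vec_eq_iff)
  define i where "i = Min S"
  have i: "k $ i \<noteq> 0" using Min_in[of S] \<open>S \<noteq> {}\<close> by (simp add: i_def S_def)
  have least: "i < j" if "k $ j \<noteq> 0" "j \<noteq> i" for j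
  proof -
    have "i \<le> j" using that(1) unfolding i_def by (intro Min_le) (auto simp: S_def)
    then show ?thesis using that(2) by simp
  qed
  define N where "N = 2 * int n + 1"
  have "N \<noteq> 0" by (simp add: N_def)
  have "N ^ Suc (coord_pos i) dvd k $ j * N ^ coord_pos j" if "j \<noteq> i" for j
  proof (cases "k $ j = 0")
    case False
    then have "Suc (coord_pos i) \<le> coord_pos j"
      using coord_pos_strict_mono[OF least] that by (simp add: Suc_le_eq)
    then show ?thesis by (intro dvd_mult le_imp_power_dvd)
  qed simp
  then have "N ^ Suc (coord_pos i) dvd (\<Sum>j\<in>UNIV - {i}. k $ j * N ^ coord_pos j)"
    by (intro dvd_sum) auto
  moreover have "k $ i * N ^ coord_pos i = - (\<Sum>j\<in>UNIV - {i}. k $ j * N ^ coord_pos j)"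
    using sum0 sum.remove[OF finite UNIV_I, of "\<lambda>j. k $ j * N ^ coord_pos j" i]
    unfolding N_def by linarith
  ultimately have "N ^ Suc (coord_pos i) dvd k $ i * N ^ coord_pos i"
    by (simp only: dvd_minus_iff)
  then have "N dvd k $ i" using \<open>N \<noteq> 0\<close> by simp
  then have "N \<le> \<bar>k $ i\<bar>" using dvd_imp_le_int[OF i] by force
  then show False using digits[of i] by (simp add: N_def)
qed

text \<open>For \<open>m \<noteq> 0\<close> the antiderivative exp(a t) / a, with a = 2 pi i m,
  takes equal values at 0 and 1 because exp(a) = 1. The case \<open>m = 0\<close> is separate since
  it would divide by 0. The form \<open>has_bochner_integral\<close> carries integrability along
  with the value, so that finite sums can be integrated termwise.\<close>

lemma has_bochner_integral_character:
  fixes m :: int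
  shows "has_bochner_integral lborel
    (\<lambda>t. indicator {0..1} t *\<^sub>R exp (2 * of_real pi * \<i> * of_real (of_int m * t)))
    (of_bool (m = 0) :: complex)"
proof (cases "m = 0")
  case True
  have "has_bochner_integral lborel (\<lambda>t. indicator {0..1::real} t *\<^sub>R (1 :: complex))
      (of_real 1 - of_real 0)"
    by (rule has_bochner_integral_FTC_Icc) (auto intro!: derivative_eq_intros)
  then show ?thesis using True by simp
next
  case False
  let ?a = "2 * of_real pi * \<i> * of_int m :: complex"
  have a: "?a \<noteq> 0" using False by simp
  have "has_bochner_integral lborel (\<lambda>t. indicator {0..1::real} t *\<^sub>R exp (?a * of_real t))
     (exp (?a * of_real 1) / ?a - exp (?a * of_real 0) / ?a)"
  proof (rule has_bochner_integral_FTC_Icc)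
    fix x :: real
    have "((\<lambda>z. exp (?a * z) / ?a) has_field_derivative exp (?a * of_real x)) (at (of_real x))"
      using a by (auto intro!: derivative_eq_intros)
    then show "((\<lambda>t. exp (?a * of_real t) / ?a) has_vector_derivative exp (?a * of_real x))
        (at x within {0..1})"
      by (rule has_vector_derivative_real_field)
  qed (auto intro!: continuous_intros)
  moreover have "exp ?a = 1"
    by (subst exp_eq_1) (auto intro!: exI[of _ m])
  ultimately show ?thesis using False by (simp add: mult_ac)
qed

text \<open>The curve is parametrized by the closed interval, but \<open>torus\<close> is a product
  of half-open ones; the endpoint 1 is a null set.\<close>

lemma has_bochner_integral_character_half_open:
  fixes m :: int
  shows "has_bochner_integral lborel
    (\<lambda>t. indicator {0..<1} t *\<^sub>R exp (2 * of_real pi * \<i> * of_real (of_int m * t)))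
    (of_bool (m = 0) :: complex)"
proof -
  have "AE t in lborel. t \<noteq> (1 :: real)" by (rule AE_lborel_singleton)
  then have "AE t in lborel.
      indicator {0..1} t *\<^sub>R exp (2 * of_real pi * \<i> * of_real (of_int m * t)) =
      indicator {0..<1} t *\<^sub>R (exp (2 * of_real pi * \<i> * of_real (of_int m * t)) :: complex)"
    by eventually_elim (auto simp: indicator_def)
  then show ?thesis
    using has_bochner_integral_character[of m]
    by (subst has_bochner_integral_cong_AE[symmetric]) auto
qed

text \<open>Fubini for products of one-variable functions: \<open>lborel\<close> is the image of the
  product measure under the coordinate map \<open>?T\<close>, so the product formula on
  \<open>?P\<close> carries over.\<close>

lemma has_bochner_integral_lborel_prod:
  fixes g :: "'a::euclidean_space \<Rightarrow> real \<Rightarrow> 'b::{real_normed_field,banach,second_countable_topology}"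
  assumes g: "\<And>b. b \<in> Basis \<Longrightarrow> has_bochner_integral lborel (g b) (I b)"
  shows "has_bochner_integral lborel (\<lambda>x. \<Prod>b\<in>Basis. g b (x \<bullet> b)) (\<Prod>b\<in>Basis. I b)"
proof -
  interpret product_sigma_finite "\<lambda>_::'a. lborel :: real measure" ..
  let ?P = "\<Pi>\<^sub>M b\<in>Basis. lborel :: real measure"
  let ?T = "\<lambda>f. \<Sum>b\<in>Basis. f b *\<^sub>R (b :: 'a)"
  have lb: "(lborel :: 'a measure) = distr ?P borel ?T"
    unfolding lborel_def[where 'a = 'a] lborel_eq_real ..
  have T: "?T \<in> measurable ?P borel" by measurable
  have int: "integrable lborel (g b)" if "b \<in> Basis" for b
    using g[OF that] by (rule integrable.intros)
  have "has_bochner_integral ?P (\<lambda>f. \<Prod>b\<in>Basis. g b (f b)) (\<Prod>b\<in>Basis. I b)"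
    using product_integral_prod[of Basis g] product_integrable_prod[of Basis g] int g
    by (auto simp: has_bochner_integral_iff)
  \<comment> \<open>Orthonormality of \<open>Basis\<close> gives
    \<open>?T f \<bullet> b = f b\<close>; this exhibits the integrand as a composition with
    \<open>?T\<close>.\<close>
  then have "has_bochner_integral ?P (\<lambda>f. \<Prod>b\<in>Basis. g b (?T f \<bullet> b)) (\<Prod>b\<in>Basis. I b)"
    by simp
  moreover have "(\<lambda>x. \<Prod>b\<in>Basis. g b (x \<bullet> b)) \<in> borel_measurable borel"
  proof (intro borel_measurable_prod)
    fix b :: 'a assume "b \<in> Basis"
    then have [measurable]: "g b \<in> borel_measurable borel"
      using borel_measurable_integrable[OF int] by simp
    show "(\<lambda>x. g b (x \<bullet> b)) \<in> borel_measurable borel" by measurable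
  qed
  ultimately show ?thesis
    unfolding lb by (intro has_bochner_integral_distr[OF _ T])
qed

lemma indicator_torus:
  "indicator torus (x :: real ^ 'd) = (\<Prod>b\<in>Basis. indicator {0..<1} (x \<bullet> b) :: real)"
proof -
  have "x \<in> torus \<longleftrightarrow> (\<forall>b\<in>Basis. x \<bullet> b \<in> {0..<1})"
    by (auto simp: torus_def Basis_vec_def inner_axis)
  then show ?thesis
    by (auto simp: indicator_def prod_zero_iff)
qed

text \<open>Indicator and character both factor over the coordinates. The integral is then a product
  of one-dimensional ones, and a single nonzero entry of \<open>k\<close> makes it vanish.\<close>

lemma has_bochner_integral_torus_character:
  fixes k :: "int ^ 'd"
  shows "has_bochner_integral lborel
    (\<lambda>x. indicator torus x *\<^sub>R exp (2 * of_real pi * \<i> * of_real (real_vec k \<bullet> x)))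
    (of_bool (k = 0) :: complex)"
proof -
  \<comment> \<open>Basis vectors are the coordinate axes, so these inner products are entries of
    \<open>k\<close>, as integral as the one-dimensional lemma requires.\<close>
  have comp: "real_vec k \<bullet> b \<in> \<int>" if "b \<in> Basis" for b
    using that by (auto simp: Basis_vec_def inner_axis real_vec_def)
  let ?g = "\<lambda>b t. indicator {0..<1} t *\<^sub>R
      (exp (2 * of_real pi * \<i> * of_real ((real_vec k \<bullet> b) * t)) :: complex)"
  have "has_bochner_integral lborel (?g b) (of_bool (real_vec k \<bullet> b = 0))" if b: "b \<in> Basis" for b
  proof -
    obtain m where "real_vec k \<bullet> b = of_int m" using comp[OF b] by (auto elim: Ints_cases)
    then show ?thesis using has_bochner_integral_character_half_open[of m] by simp
  qed
  then have "has_bochner_integral lborel (\<lambda>x. \<Prod>b\<in>Basis. ?g b (x \<bullet> b))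
      (\<Prod>b\<in>Basis. of_bool (real_vec k \<bullet> b = 0))"
    by (rule has_bochner_integral_lborel_prod)
  moreover have "(\<Prod>b\<in>Basis. ?g b (x \<bullet> b)) =
      indicator torus x *\<^sub>R exp (2 * of_real pi * \<i> * of_real (real_vec k \<bullet> x))" for x
    by (subst euclidean_inner)
       (simp add: indicator_torus scaleR_conv_of_real prod.distrib exp_sum sum_distrib_left)
  moreover have "(\<Prod>b\<in>Basis. of_bool (real_vec k \<bullet> b = 0)) = (of_bool (k = 0) :: complex)"
  proof -
    have "k = 0 \<longleftrightarrow> real_vec k = 0" by (simp add: vec_eq_iff real_vec_def)
    also have "\<dots> \<longleftrightarrow> (\<forall>b\<in>Basis. real_vec k \<bullet> b = 0)"
      by (auto simp: euclidean_all_zero_iff)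
    finally show ?thesis by (auto simp: prod_zero_iff)
  qed
  ultimately show ?thesis by simp
qed

lemma torus_integral_character_sum:
  fixes f :: "real ^ 'd \<Rightarrow> complex"
  assumes "\<And>x. x \<in> torus \<Longrightarrow>
    f x = (\<Sum>k\<in>freqs n. c k * exp (2 * of_real pi * \<i> * of_real (real_vec k \<bullet> x)))"
  shows "torus_integral f = c 0"
proof -
  have "has_bochner_integral lborel
     (\<lambda>x. \<Sum>k\<in>freqs n. c k * (indicator torus x *\<^sub>R
        exp (2 * of_real pi * \<i> * of_real (real_vec k \<bullet> x))))
     (\<Sum>k\<in>freqs n. c k * of_bool (k = 0))"
    by (intro has_bochner_integral_sum has_bochner_integral_mult_right
        has_bochner_integral_torus_character)
  moreover have "(\<Sum>k\<in>freqs n. c k * (indicator torus x *\<^sub>R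
      exp (2 * of_real pi * \<i> * of_real (real_vec k \<bullet> x)))) = indicator torus x *\<^sub>R f x" for x
    \<comment> \<open>Off the torus \<open>f\<close> is arbitrary, but the indicator makes both
      sides 0.\<close>
    by (cases "x \<in> torus") (simp_all add: assms)
  moreover have "(\<Sum>k\<in>freqs n. c k * of_bool (k = 0)) = c 0"
    by (simp add: sum.remove[OF finite_freqs zero_in_freqs])
  ultimately show ?thesis
    by (simp add: torus_integral_def set_lebesgue_integral_def has_bochner_integral_iff)
qed

text \<open>Reduction mod 1 subtracts the integer vector of floors, which changes the inner product
  with \<open>real_vec k\<close> by an integer, hence the exponent by a period of
  \<open>exp\<close>.\<close>

lemma exp_inner_mod1:
  "exp (2 * of_real pi * \<i> * of_real (real_vec k \<bullet> mod1 x)) =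
   (exp (2 * of_real pi * \<i> * of_real (real_vec k \<bullet> x)) :: complex)"
proof -
  have "real_vec k \<bullet> x = real_vec k \<bullet> mod1 x + of_int (\<Sum>i\<in>UNIV. k $ i * \<lfloor>x $ i\<rfloor>)"
    by (simp add: inner_vec_def real_vec_def mod1_def frac_def algebra_simps
        flip: sum.distrib)
  then show ?thesis
    by (subst exp_eq, intro exI[of _ "- (\<Sum>i\<in>UNIV. k $ i * \<lfloor>x $ i\<rfloor>)"])
       (simp add: algebra_simps)
qed

lemma mod1_in_torus: "mod1 x \<in> torus"
  by (simp add: mod1_def torus_def frac_lt_1)

text \<open>The straight line is itself a differentiable lift of \<gamma>, and uniqueness of the
  velocity lets \<open>THE\<close> pick its slope.\<close>

lemma torus_velocity_mod1_linear:
  assumes "\<And>t. t \<in> {0..1} \<Longrightarrow> \<gamma> t = mod1 (t *\<^sub>R v)" and "t \<in> {0..1}"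
  shows "torus_velocity \<gamma> t = v"
proof -
  have "((\<lambda>s. s *\<^sub>R v) has_vector_derivative v) (at t within {0..1})"
    by (auto intro!: derivative_eq_intros)
  then have "has_torus_velocity \<gamma> v t"
    unfolding has_torus_velocity_def using assms(1) by (intro exI[of _ "\<lambda>s. s *\<^sub>R v"]) auto
  then show ?thesis
    unfolding torus_velocity_def using has_torus_velocity_unique[OF assms(2)] by blast
qed

lemma curve_length_mod1_linear:
  assumes "\<And>t. t \<in> {0..1} \<Longrightarrow> \<gamma> t = mod1 (t *\<^sub>R v)"
  shows "curve_length \<gamma> = norm v"
proof -
  have vel: "torus_velocity \<gamma> t = v" if "0 \<le> t" "t \<le> 1" for t
    by (rule torus_velocity_mod1_linear[OF assms]) (use that in auto)
  have "curve_length \<gamma> = (LINT t:{0..1::real}|lborel. norm v)"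
    unfolding curve_length_def
    by (intro set_lebesgue_integral_cong) (simp_all add: vel)
  then show ?thesis by (simp add: set_integral_const)
qed

lemma curve_integral_mod1_linear:
  assumes "\<And>t. t \<in> {0..1} \<Longrightarrow> \<gamma> t = mod1 (t *\<^sub>R v)"
  shows "curve_integral \<gamma> g = of_real (norm v) * (LINT t:{0..1}|lborel. g (\<gamma> t))"
proof -
  have vel: "torus_velocity \<gamma> t = v" if "0 \<le> t" "t \<le> 1" for t
    by (rule torus_velocity_mod1_linear[OF assms]) (use that in auto)
  have "curve_integral \<gamma> g = (LINT t:{0..1}|lborel. g (\<gamma> t) * of_real (norm v))"
    unfolding curve_integral_def
    by (intro set_lebesgue_integral_cong) (simp_all add: vel)
  then show ?thesis by (simp add: mult.commute)
qed

theorem theorem4p1: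
  fixes f :: "(real, 'd :: {finite, linorder}) vec \<Rightarrow> complex"
    and \<gamma> :: "real \<Rightarrow> (real, 'd) vec"
    and n :: nat
  assumes "1 \<le> n"
    and "f \<in> trig_polys n"
    and "\<And>y. y \<in> {0..1} \<Longrightarrow> \<gamma> y = mod1 (\<chi> i. (2 * real n + 1) ^ coord_pos i * y)"
  shows "of_real (1 / curve_length \<gamma>) * curve_integral \<gamma> f = torus_integral f"
proof -
  define v :: "(real, 'd) vec" where "v = (\<chi> i. (2 * real n + 1) ^ coord_pos i)"
  have \<gamma>: "\<gamma> t = mod1 (t *\<^sub>R v)" if "t \<in> {0..1}" for t
  proof -
    have "(\<chi> i. (2 * real n + 1) ^ coord_pos i * t) = t *\<^sub>R v"
      by (simp add: v_def vec_eq_iff)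
    then show ?thesis using assms(3)[OF that] by simp
  qed
  \<comment> \<open>All entries are powers of 2n + 1 > 0. This makes the length
    \<open>norm v\<close> nonzero, so that it cancels at the end.\<close>
  have "v \<noteq> 0" by (simp add: v_def vec_eq_iff)
  obtain c where c: "\<And>x. x \<in> torus \<Longrightarrow>
      f x = (\<Sum>k\<in>freqs n. c k * exp (2 * of_real pi * \<i> * of_real (real_vec k \<bullet> x)))"
    using assms(2) unfolding trig_polys_def by auto
  define m :: "(int, 'd) vec \<Rightarrow> int"
    where "m k = (\<Sum>i\<in>UNIV. k $ i * (2 * int n + 1) ^ coord_pos i)" for k
  have m: "real_vec k \<bullet> (t *\<^sub>R v) = of_int (m k) * t" for k t
    by (simp add: m_def v_def inner_vec_def real_vec_def sum_distrib_left mult_ac)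
  have m0: "m k = 0 \<longleftrightarrow> k = 0" if "k \<in> freqs n" for k
    using balanced_digits_eq_0[OF freqs_component[OF that]] by (auto simp: m_def)
  have "has_bochner_integral lborel
     (\<lambda>t. \<Sum>k\<in>freqs n. c k * (indicator {0..1} t *\<^sub>R
        exp (2 * of_real pi * \<i> * of_real (of_int (m k) * t))))
     (\<Sum>k\<in>freqs n. c k * of_bool (m k = 0))"
    by (intro has_bochner_integral_sum has_bochner_integral_mult_right
        has_bochner_integral_character)
  moreover have "(\<Sum>k\<in>freqs n. c k * (indicator {0..1} t *\<^sub>R
        exp (2 * of_real pi * \<i> * of_real (of_int (m k) * t)))) =
      indicator {0..1} t *\<^sub>R f (\<gamma> t)" for t
    \<comment> \<open>The expansion of \<open>f\<close> is available only on \<open>torus\<close>,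
      so it is applied at the reduced point; then \<open>exp_inner_mod1\<close> passes to the lift
      \<open>t *\<^sub>R v\<close>, where \<open>m\<close> gives the frequency.\<close>
    by (cases "t \<in> {0..1}") (simp_all only: \<gamma> c mod1_in_torus exp_inner_mod1 m, simp_all)
  \<comment> \<open>By \<open>m0\<close> no other frequency in \<open>freqs n\<close> collapses to 0
    along the curve, so only the constant coefficient survives, as on the torus.\<close>
  moreover have "(\<Sum>k\<in>freqs n. c k * of_bool (m k = 0)) = c 0"
    by (simp add: sum.remove[OF finite_freqs zero_in_freqs] m0 zero_in_freqs)
  ultimately have "(LINT t:{0..1}|lborel. f (\<gamma> t)) = c 0"
    by (simp add: set_lebesgue_integral_def has_bochner_integral_iff)
  moreover have "curve_length \<gamma> = norm v"
    using \<gamma> by (rule curve_length_mod1_linear)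
  moreover have "curve_integral \<gamma> f = of_real (norm v) * (LINT t:{0..1}|lborel. f (\<gamma> t))"
    using \<gamma> by (rule curve_integral_mod1_linear)
  moreover have "torus_integral f = c 0"
    using c by (rule torus_integral_character_sum)
  ultimately show ?thesis using \<open>v \<noteq> 0\<close> by simp
qed

end
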